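(* Fix a defender response $\phi=[\mathrm{sp}^{\rm d},\gamma]\in\Phi$. If $\widehat\delta$ is the attack vector computed by the pivot-node greedy algorithm described in the context, then $\widehat\delta$ is an optimal attack vector of the LPF master problem $$\max_{\delta\in\mathcal D_M}\ \widehat{\mathrm L}(\widehat{\mathrm x}(\delta,\phi))\quad\text{s.t. }\widehat{\mathrm x}(\delta,\phi)\in\widehat{\mathcal X}.$$ The same holds for the $\epsilon$-LPF master problem $\max_{\delta\in\mathcal D_M}\check{\mathrm L}(\check{\mathrm x}(\delta,\phi))$ s.t. $\check{\mathrm x}(\delta,\phi)\in\check{\mathcal X}$ (with the algorithm run using the $\epsilon$-LPF quantities).
   Context: Conventions. $\mathbf j=\sqrt{-1}$; a bar over $z_j$ or $Z_{ij}$ is complex conjugation; inequalities between complex numbers or vectors are componentwise (real and imaginary parts separately); $\odot$ is the entrywise product; $(t)_+=\max(t,0)$. Network. $(\mathcal N\cup\{0\},\mathcal E)$ is a finite tree rooted at the substation node $0$, $N=|\mathcal N|$; a line $(i,j)\in\mathcal E$ goes from parent $i$ to child $j$, and its quantities are indexed by $j$. Its impedance is $z_j=r_j+\mathbf j x_j$ with $r_j,x_j>0$. $\mathcal P_i$ is the set of nodes on the path from $0$ to $i$, including $i$ and excluding $0$. $Z_{ij}=\sum_{k\in\mathcal P_i\cap\mathcal P_j}z_k=R_{ij}+\mathbf jX_{ij}$. $H$ is the height of the tree. Fixed data: the squared substation voltage $\nu_0$; nominal demands $\mathrm{sc}^{\rm nom}_i=\mathrm{pc}^{\rm nom}_i+\mathbf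 j\,\mathrm{qc}^{\rm nom}_i$; DER (distributed energy resource) capabilities $\overline{\mathrm{sp}}_i$; soft voltage bounds $\underline\nu_i\le\overline\nu_i$; hard bounds $0<\underline\mu<\min_i\underline\nu_i\le\max_i\overline\nu_i<\overline\mu$; weights $W,C\in\mathbb R_+^{N}$; load-control limits $\underline\gamma_i\ge0$. Let $\mathcal S_i=\{p\in\mathbb C:\mathrm{Re}(p)\ge0,\ |p|\le\overline{\mathrm{sp}}_i\}$, $\mathcal S=\prod_i\mathcal S_i$, $\Gamma=\prod_i[\underline\gamma_i,1]$. Strategies (no DER is secured). The attacker picks an attack vector $\delta\in\mathcal D_M=\{\delta\in\{0,1\}^{\mathcal N}:\|\delta\|_0\le M\}$ with $M\le N$ fixed; compromised DERs are given the set-points $\mathrm{sp}^{\rm a}_i=-\mathbf j\,\overline{\mathrm{sp}}_i$. The defender picks $\phi=[\mathrm{sp}^{\rm d},\gamma]\in\Phi=\mathcal S\times\Gamma$. They determine consumption and generation $sc_i=\gamma_i\,\mathrm{sc}^{\rm nom}_i$, $sg_i=-\delta_i\mathbf j\,\overline{\mathrm{sp}}_i+(1-\delta_i)\mathrm{sp}^{\rm d}_i$. Power flow models. A state is $\mathrm x=[\nu,\ell,sc,sg,S]\in\mathbb R_+^{2N}\times\mathbb C^{3N}$. For all $(i,j)\in\mathcal E$: NPF: $S_j=\sum_{k:(j,k)\in\mathcal E}S_k+sc_j-sg_j+z_j\ell_j$, $\nu_j=\nu_i-2\mathrm{Re}(\bar z_jS_j)+|z_j|^2\ell_j$, $\ell_j=|S_j|^2/\nu_i$.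 LPF: $\widehat S_j=\sum_{k:(j,k)\in\mathcal E}\widehat S_k+sc_j-sg_j$, $\widehat\nu_j=\widehat\nu_i-2\mathrm{Re}(\bar z_j\widehat S_j)$, $\widehat\ell_j=|\widehat S_j|^2/\widehat\nu_i$. $\epsilon$-LPF: $\check S_j=\sum_{k:(j,k)\in\mathcal E}\check S_k+(1+\epsilon)(sc_j-sg_j)$, $\check\nu_j=\check\nu_i-2\mathrm{Re}(\bar z_j\check S_j)$, $\check\ell_j=|\check S_j|^2/\check\nu_i$, where $\epsilon=(1-\epsilon_0)^{-H}-1$. (The substation's squared voltage is $\nu_0$ in all models.) $\mathcal X,\widehat{\mathcal X},\check{\mathcal X}$ are the sets of states of the respective models satisfying the hard bounds $\underline\mu\le\nu_i\le\overline\mu$, $sc\le\mathrm{sc}^{\rm nom}$, $sg_i\le \mathrm{sp}_i$ for set-points $\mathrm{sp}_i\in\mathcal S_i$, and no reverse flow $S\ge0$. $\widehat{\mathrm x}(\delta,\phi),\check{\mathrm x}(\delta,\phi)$ denote the LPF and $\epsilon$-LPF states with the $sc,sg$ determined by $(\delta,\phi)$. Losses. $\mathrm L_{VR}(\mathrm x)=\|W\odot(\underline\nu-\nu)_+\|_\infty$, $\mathrm L_{LC}(\mathrm x)=\|C\odot(1-\gamma)\odot\mathrm{pc}^{\rm nom}\|_1$; $\widehat{\mathrm L}(\widehat{\mathrm x})=\mathrm L_{VR}(\widehat{\mathrm x})+\mathrm L_{LC}(\widehat{\mathrm x})$, $\check{\mathrm L}(\check{\mathrm x})=\mathrm L_{VR}(\check{\mathrm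 x})+\mathrm L_{LC}(\check{\mathrm x})$. Standing assumptions (A0). (i) Without attack the states in $\mathcal X$ and $\widehat{\mathcal X}$ satisfy $\underline\nu_i\le\nu_i\le\overline\nu_i$. (ii) The hard voltage bounds hold for all strategy profiles. (iii) There are no reverse power flows: all power flows are $\ge0$ (hence all squared nodal voltages are $\le\nu_0$). (iv) $\nu_0=1$, $|S_j|<1$ for all lines, $r_j\le\frac{\underline\mu^2}{4\underline\mu+8}<1$, $x_j\le\frac{\underline\mu^2}{4\underline\mu+8}<1$, and $R_{ii}\le1$, $X_{ii}\le1$ for all $i$. (v) $z\odot\ell\le\epsilon_0S$ for every $\mathrm x\in\mathcal X$, where $\epsilon_0$ is a small positive number. Pivot-node greedy algorithm (LPF version, for given $\phi$). Compute the no-attack state $\widehat{\mathrm x}(\mathbf 0,\phi)$ with squared voltages $\widehat\nu_i$. For $i,j\in\mathcal N$ let $\Delta_j(\widehat\nu_i)=2\mathrm{Re}(\bar Z_{ij}(\mathrm{sp}^{\rm d}_j+\mathbf j\,\overline{\mathrm{sp}}_j))$ (multiplied by $1+\epsilon$ in the $\epsilon$-LPF version). For each pivot node $i\in\mathcal N$ let $\widehat\delta^i\in\mathcal D_M$ be the attack vector compromising $M$ nodes with the largest values of $\Delta_j(\widehat\nu_i)$ (ties broken arbitrarily), and let $\widehat\nu_i'=\widehat\nu_i-\sum_{j:\widehat\delta^i_j=1}\Delta_j(\widehat\nu_i)$. Choose $k\in\operatorname{argmax}_{i\in\mathcal N}W_i(\underline\nu_i-\widehat\nu_i')$ and return $\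widehat\delta=\widehat\delta^k$.
   Formalization: The nominal demands are assumed componentwise nonnegative; otherwise sc ≤ sc^nom can fail for a load control γ_i < 1 at an interior node, so that no attack vector is feasible and none is optimal. *)

theory Defs
  imports Complex_Main "HOL-Library.Cardinality"
begin

text \<open>
  Nodes other than the substation are the elements of a finite type \<open>'n\<close>; \<^term>\<open>None\<close> is the
  substation. A line is indexed by its child node.
\<close>

definition cle :: "complex \<Rightarrow> complex \<Rightarrow> bool" (infix \<open>\<le>\<^sub>c\<close> 50) where
  "a \<le>\<^sub>c b \<longleftrightarrow> Re a \<le> Re b \<and> Im a \<le> Im b"

definition rooted_tree :: "'v set \<Rightarrow> ('v \<times> 'v) set \<Rightarrow> 'v \<Rightarrow> bool" where
  "rooted_tree V E r \<longleftrightarrow>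
     finite V \<and> r \<in> V \<and> E \<subseteq> V \<times> V \<and>
     (\<nexists>u. (u, r) \<in> E) \<and>
     (\<forall>v \<in> V - {r}. \<exists>!u. (u, v) \<in> E) \<and>
     (\<forall>v \<in> V. (r, v) \<in> E\<^sup>*)"

record 'n network =
  lines :: "('n option \<times> 'n option) set"
  imp :: "'n \<Rightarrow> complex"                      \<comment> \<open>\<open>z\<^sub>j = r\<^sub>j + \<i> x\<^sub>j\<close>\<close>
  nu0 :: real
  sc_nom :: "'n \<Rightarrow> complex"                   \<comment> \<open>\<open>pc\<^sub>i + \<i> qc\<^sub>i\<close>, nominal\<close>
  sp_cap :: "'n \<Rightarrow> real"                      \<comment> \<open>apparent power capability of the DER\<close>
  nu_lo :: "'n \<Rightarrow> real"
  nu_hi :: "'n \<Rightarrow> real"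
  mu_lo :: real
  mu_hi :: real
  w_VR :: "'n \<Rightarrow> real"                        \<comment> \<open>\<open>W\<close>\<close>
  c_LC :: "'n \<Rightarrow> real"                        \<comment> \<open>\<open>C\<close>\<close>
  gamma_lo :: "'n \<Rightarrow> real"

record 'n pf_state =
  nu :: "'n \<Rightarrow> real"
  ell :: "'n \<Rightarrow> real"
  sc :: "'n \<Rightarrow> complex"
  sg :: "'n \<Rightarrow> complex"
  flow :: "'n \<Rightarrow> complex"                     \<comment> \<open>\<open>S\<close>\<close>

text \<open>
  Nonnegativity of the nominal demands expresses that they are demands: it is what makes
  \<open>\<gamma>\<^sub>i sc\<^sub>i\<close> respect the consumption bound \<open>sc \<le> sc\<^sup>n\<^sup>o\<^sup>m\<close> for every load control \<open>\<gamma>\<^sub>i \<le> 1\<close>.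
\<close>

definition network_data :: "'n::finite network \<Rightarrow> bool" where
  "network_data G \<longleftrightarrow>
     rooted_tree UNIV (lines G) None \<and>
     (\<forall>j. 0 < Re (imp G j) \<and> 0 < Im (imp G j)) \<and>
     (\<forall>i. 0 \<le>\<^sub>c sc_nom G i) \<and>
     0 < mu_lo G \<and>
     (\<forall>i. mu_lo G < nu_lo G i \<and> nu_lo G i \<le> nu_hi G i \<and> nu_hi G i < mu_hi G) \<and>
     (\<forall>i. 0 \<le> w_VR G i \<and> 0 \<le> c_LC G i \<and> 0 \<le> gamma_lo G i)"

subsection \<open>Topology\<close>

text \<open>In a rooted tree the nodes on the path from the root to \<open>i\<close> are the ancestors of \<open>i\<close>.\<close>

definition path_nodes :: "'n::finite network \<Rightarrow> 'n \<Rightarrow> 'n set" where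
  "path_nodes G i = {k. (Some k, Some i) \<in> (lines G)\<^sup>*}"

definition children :: "'n::finite network \<Rightarrow> 'n \<Rightarrow> 'n set" where
  "children G j = {k. (Some j, Some k) \<in> lines G}"

definition common_imp :: "'n::finite network \<Rightarrow> 'n \<Rightarrow> 'n \<Rightarrow> complex" where
  "common_imp G i j = (\<Sum>k \<in> path_nodes G i \<inter> path_nodes G j. imp G k)"

text \<open>As the root is left out, \<^term>\<open>card (path_nodes G i)\<close> is the number of lines from the root to \<open>i\<close>.\<close>

definition height :: "'n::finite network \<Rightarrow> nat" where
  "height G = Max (range (\<lambda>i. card (path_nodes G i)))"

definition eps :: "'n::finite network \<Rightarrow> real \<Rightarrow> real" where
  "eps G e0 = (1 - e0) powi (- int (height G)) - 1"

subsection \<open>Strategies\<close>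

text \<open>A defender response is a pair \<open>(sp\<^sup>d, \<gamma>)\<close>; an attack vector is a 0/1-valued function.\<close>

type_synonym 'n response = "('n \<Rightarrow> complex) \<times> ('n \<Rightarrow> real)"
type_synonym 'n attack = "'n \<Rightarrow> real"

definition setpoints :: "'n::finite network \<Rightarrow> ('n \<Rightarrow> complex) set" where
  "setpoints G = {p. \<forall>i. 0 \<le> Re (p i) \<and> cmod (p i) \<le> sp_cap G i}"

definition load_controls :: "'n::finite network \<Rightarrow> ('n \<Rightarrow> real) set" where
  "load_controls G = {\<gamma>. \<forall>i. gamma_lo G i \<le> \<gamma> i \<and> \<gamma> i \<le> 1}"

definition responses :: "'n::finite network \<Rightarrow> 'n response set" where
  "responses G = setpoints G \<times> load_controls G"

definition attacks :: "nat \<Rightarrow> ('n::finite) attack set" where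
  "attacks M = {\<delta>. (\<forall>i. \<delta> i \<in> {0, 1}) \<and> card {i. \<delta> i \<noteq> 0} \<le> M}"

definition consumption :: "'n::finite network \<Rightarrow> 'n response \<Rightarrow> 'n \<Rightarrow> complex" where
  "consumption G \<phi> i = of_real (snd \<phi> i) * sc_nom G i"

definition generation :: "'n::finite network \<Rightarrow> 'n attack \<Rightarrow> 'n response \<Rightarrow> 'n \<Rightarrow> complex" where
  "generation G \<delta> \<phi> i =
     - (of_real (\<delta> i) * \<i> * of_real (sp_cap G i)) + (1 - of_real (\<delta> i)) * fst \<phi> i"

definition realises :: "'n::finite network \<Rightarrow> 'n attack \<Rightarrow> 'n response \<Rightarrow> 'n pf_state \<Rightarrow> bool" where
  "realises G \<delta> \<phi> x \<longleftrightarrow> sc x = consumption G \<phi> \<and> sg x = generation G \<delta> \<phi>"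

subsection \<open>Power flow models\<close>

definition bus_nu :: "'n::finite network \<Rightarrow> 'n pf_state \<Rightarrow> 'n option \<Rightarrow> real" where
  "bus_nu G x b = (case b of None \<Rightarrow> nu0 G | Some i \<Rightarrow> nu x i)"

definition npf :: "'n::finite network \<Rightarrow> 'n pf_state \<Rightarrow> bool" where
  "npf G x \<longleftrightarrow> (\<forall>i j. (i, Some j) \<in> lines G \<longrightarrow>
     flow x j = (\<Sum>k \<in> children G j. flow x k) + sc x j - sg x j + imp G j * of_real (ell x j) \<and>
     nu x j = bus_nu G x i - 2 * Re (cnj (imp G j) * flow x j) + (cmod (imp G j))\<^sup>2 * ell x j \<and>
     ell x j = (cmod (flow x j))\<^sup>2 / bus_nu G x i)"

text \<open>
  The linear model with net demand scaled by \<open>\<kappa>\<close>: LPF is \<open>\<kappa> = 1\<close> and \<open>\<epsilon>\<close>-LPF is \<open>\<kappa> = 1 + \<epsilon>\<close>.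
\<close>

definition lpf :: "'n::finite network \<Rightarrow> real \<Rightarrow> 'n pf_state \<Rightarrow> bool" where
  "lpf G \<kappa> x \<longleftrightarrow> (\<forall>i j. (i, Some j) \<in> lines G \<longrightarrow>
     flow x j = (\<Sum>k \<in> children G j. flow x k) + of_real \<kappa> * (sc x j - sg x j) \<and>
     nu x j = bus_nu G x i - 2 * Re (cnj (imp G j) * flow x j) \<and>
     ell x j = (cmod (flow x j))\<^sup>2 / bus_nu G x i)"

definition hard_bounds :: "'n::finite network \<Rightarrow> 'n pf_state \<Rightarrow> bool" where
  "hard_bounds G x \<longleftrightarrow> (\<forall>i. mu_lo G \<le> nu x i \<and> nu x i \<le> mu_hi G)"

definition soft_bounds :: "'n::finite network \<Rightarrow> 'n pf_state \<Rightarrow> bool" where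
  "soft_bounds G x \<longleftrightarrow> (\<forall>i. nu_lo G i \<le> nu x i \<and> nu x i \<le> nu_hi G i)"

definition no_reverse_flow :: "'n::finite pf_state \<Rightarrow> bool" where
  "no_reverse_flow x \<longleftrightarrow> (\<forall>j. 0 \<le>\<^sub>c flow x j)"

definition admissible :: "'n::finite network \<Rightarrow> 'n pf_state \<Rightarrow> bool" where
  "admissible G x \<longleftrightarrow>
     (\<forall>i. 0 \<le> nu x i \<and> 0 \<le> ell x i) \<and>
     hard_bounds G x \<and>
     (\<forall>i. sc x i \<le>\<^sub>c sc_nom G i) \<and>
     (\<exists>sp \<in> setpoints G. \<forall>i. sg x i \<le>\<^sub>c sp i) \<and>
     no_reverse_flow x"

definition npf_states :: "'n::finite network \<Rightarrow> 'n pf_state set" where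
  "npf_states G = {x. npf G x \<and> admissible G x}"

definition lpf_states :: "'n::finite network \<Rightarrow> real \<Rightarrow> 'n pf_state set" where
  "lpf_states G \<kappa> = {x. lpf G \<kappa> x \<and> admissible G x}"

text \<open>On a rooted tree the linear equations determine the state uniquely from \<open>sc\<close> and \<open>sg\<close>.\<close>

definition lpf_state :: "'n::finite network \<Rightarrow> real \<Rightarrow> 'n attack \<Rightarrow> 'n response \<Rightarrow> 'n pf_state" where
  "lpf_state G \<kappa> \<delta> \<phi> = (THE x. lpf G \<kappa> x \<and> realises G \<delta> \<phi> x)"

subsection \<open>Losses and the master problem\<close>

definition loss_VR :: "'n::finite network \<Rightarrow> 'n pf_state \<Rightarrow> real" where
  "loss_VR G x = Max (range (\<lambda>i. \<bar>w_VR G i * max (nu_lo G i - nu x i) 0\<bar>))"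

definition loss_LC :: "'n::finite network \<Rightarrow> ('n \<Rightarrow> real) \<Rightarrow> real" where
  "loss_LC G \<gamma> = (\<Sum>i\<in>UNIV. \<bar>c_LC G i * (1 - \<gamma> i) * Re (sc_nom G i)\<bar>)"

definition lpf_loss :: "'n::finite network \<Rightarrow> real \<Rightarrow> 'n attack \<Rightarrow> 'n response \<Rightarrow> real" where
  "lpf_loss G \<kappa> \<delta> \<phi> = loss_VR G (lpf_state G \<kappa> \<delta> \<phi>) + loss_LC G (snd \<phi>)"

definition optimal_attack ::
    "'n::finite network \<Rightarrow> real \<Rightarrow> nat \<Rightarrow> 'n response \<Rightarrow> 'n attack \<Rightarrow> bool" where
  "optimal_attack G \<kappa> M \<phi> \<delta> \<longleftrightarrow>
     is_arg_max (\<lambda>\<delta>. lpf_loss G \<kappa> \<delta> \<phi>)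
       (\<lambda>\<delta>. \<delta> \<in> attacks M \<and> lpf_state G \<kappa> \<delta> \<phi> \<in> lpf_states G \<kappa>) \<delta>"

subsection \<open>Standing assumptions\<close>

text \<open>
  Voltage quality concerns the normal operating point of the network, hence the existential over the
  response. Demanding the soft bounds for every response would make the voltage loss vanish
  identically: the set-points forced by an attack also belong to \<^const>\<open>setpoints\<close>, so each LPF
  state under attack is the no-attack state of some other response.
\<close>

definition voltage_quality :: "'n::finite network \<Rightarrow> bool" where
  "voltage_quality G \<longleftrightarrow> (\<exists>\<phi> \<in> responses G.
     (\<forall>x \<in> npf_states G. realises G (\<lambda>_. 0) \<phi> x \<longrightarrow> soft_bounds G x) \<and>
     soft_bounds G (lpf_state G 1 (\<lambda>_. 0) \<phi>))"

text \<open>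
  The NPF equations are quadratic and also have spurious low-voltage solutions, so for NPF only
  the existence of a solution within the bounds is required.
\<close>

definition secure_operation :: "'n::finite network \<Rightarrow> nat \<Rightarrow> real \<Rightarrow> bool" where
  "secure_operation G M e0 \<longleftrightarrow> (\<forall>\<delta> \<in> attacks M. \<forall>\<phi> \<in> responses G.
     (\<exists>x. npf G x \<and> realises G \<delta> \<phi> x \<and> hard_bounds G x \<and> no_reverse_flow x) \<and>
     (\<forall>\<kappa> \<in> {1, 1 + eps G e0}.
        hard_bounds G (lpf_state G \<kappa> \<delta> \<phi>) \<and> no_reverse_flow (lpf_state G \<kappa> \<delta> \<phi>)))"

definition per_unit_bounds :: "'n::finite network \<Rightarrow> nat \<Rightarrow> bool" where
  "per_unit_bounds G M \<longleftrightarrow>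
     nu0 G = 1 \<and>
     (\<forall>\<delta> \<in> attacks M. \<forall>\<phi> \<in> responses G. \<forall>x \<in> npf_states G.
        realises G \<delta> \<phi> x \<longrightarrow> (\<forall>j. cmod (flow x j) < 1)) \<and>
     (let b = (mu_lo G)\<^sup>2 / (4 * mu_lo G + 8)
      in b < 1 \<and> (\<forall>j. Re (imp G j) \<le> b \<and> Im (imp G j) \<le> b)) \<and>
     (\<forall>i. Re (common_imp G i i) \<le> 1 \<and> Im (common_imp G i i) \<le> 1)"

text \<open>
  The bound is imposed on states realised by strategy profiles only. Membership in
  \<^const>\<open>npf_states\<close> bounds \<open>sc\<close> and \<open>sg\<close> from above but not from below; over all such states it would
  fail for any flow that is nonzero with zero imaginary part.
\<close>

definition small_line_losses :: "'n::finite network \<Rightarrow> nat \<Rightarrow> real \<Rightarrow> bool" where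
  "small_line_losses G M e0 \<longleftrightarrow> 0 < e0 \<and> e0 < 1 \<and>
     (\<forall>\<delta> \<in> attacks M. \<forall>\<phi> \<in> responses G. \<forall>x \<in> npf_states G. realises G \<delta> \<phi> x \<longrightarrow>
        (\<forall>j. imp G j * of_real (ell x j) \<le>\<^sub>c of_real e0 * flow x j))"

definition standing_assumptions :: "'n::finite network \<Rightarrow> nat \<Rightarrow> real \<Rightarrow> bool" where
  "standing_assumptions G M e0 \<longleftrightarrow> voltage_quality G \<and> secure_operation G M e0 \<and> per_unit_bounds G M \<and> small_line_losses G M e0"

subsection \<open>Pivot-node greedy algorithm\<close>

definition Delta :: "'n::finite network \<Rightarrow> real \<Rightarrow> 'n response \<Rightarrow> 'n \<Rightarrow> 'n \<Rightarrow> real" where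
  "Delta G \<kappa> \<phi> i j =
     \<kappa> * (2 * Re (cnj (common_imp G i j) * (fst \<phi> j + \<i> * of_real (sp_cap G j))))"

definition pivot_attack ::
    "'n::finite network \<Rightarrow> real \<Rightarrow> nat \<Rightarrow> 'n response \<Rightarrow> 'n \<Rightarrow> 'n attack \<Rightarrow> bool" where
  "pivot_attack G \<kappa> M \<phi> i \<delta> \<longleftrightarrow>
     \<delta> \<in> attacks M \<and> card {j. \<delta> j = 1} = M \<and>
     (\<forall>j l. \<delta> j = 1 \<and> \<delta> l = 0 \<longrightarrow> Delta G \<kappa> \<phi> i l \<le> Delta G \<kappa> \<phi> i j)"

definition pivot_nu ::
    "'n::finite network \<Rightarrow> real \<Rightarrow> 'n response \<Rightarrow> 'n \<Rightarrow> 'n attack \<Rightarrow> real" where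
  "pivot_nu G \<kappa> \<phi> i \<delta> =
     nu (lpf_state G \<kappa> (\<lambda>_. 0) \<phi>) i - (\<Sum>j | \<delta> j = 1. Delta G \<kappa> \<phi> i j)"

text \<open>
  The algorithm breaks ties arbitrarily, so it is a relation: \<open>d i\<close> is the attack vector chosen
  for pivot \<open>i\<close>, and \<open>k\<close> the pivot selected in the end.
\<close>

definition greedy_output ::
    "'n::finite network \<Rightarrow> real \<Rightarrow> nat \<Rightarrow> 'n response \<Rightarrow> 'n attack \<Rightarrow> bool" where
  "greedy_output G \<kappa> M \<phi> \<delta> \<longleftrightarrow> (\<exists>d k.
     (\<forall>i. pivot_attack G \<kappa> M \<phi> i (d i)) \<and>
     is_arg_max (\<lambda>i. w_VR G i * (nu_lo G i - pivot_nu G \<kappa> \<phi> i (d i))) (\<lambda>_. True) k \<and>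
     \<delta> = d k)"

end

theory Submission
  imports Defs
begin

text \<open>
  On a tree the linear equations have the explicit solution in which a flow is the net demand of the
  subtree below the line, so that
  \<open>\<nu>\<^sub>i = \<nu>\<^sub>0 - 2 \<Sum>\<^sub>m Re (cnj Z\<^sub>i\<^sub>m d\<^sub>m)\<close> for the net demand \<open>d\<close>. Hence
  compromising a DER \<open>j\<close> lowers \<open>\<nu>\<^sub>i\<close> by \<open>\<Delta>\<^sub>j(\<nu>\<^sub>i) \<ge> 0\<close>,
  independently of the other compromised DERs, and the \<open>M\<close> largest values minimise \<open>\<nu>\<^sub>i\<close> over all attacks. The voltage loss is a maximum over \<open>i\<close> of nonincreasing functions of
  \<open>\<nu>\<^sub>i\<close>, so the two maximisations, over \<open>i\<close> and over attacks, may be exchanged.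
\<close>

section \<open>Paths and subtrees\<close>

lemma rooted_tree_parent_unique:
  assumes "rooted_tree V E r" "(u, v) \<in> E" "(u', v) \<in> E"
  shows "u = u'"
proof -
  have "v \<in> V - {r}" using assms by (auto simp: rooted_tree_def)
  then have "\<exists>!u. (u, v) \<in> E" using assms(1) unfolding rooted_tree_def by blast
  then show ?thesis using assms(2,3) by blast
qed

text \<open>A cycle through \<open>v\<close> enters \<open>v\<close> by its only incoming edge, so
  it also passes through the parent of \<open>v\<close>. Repeating this moves the cycle up to the
  root, which has no incoming edge.\<close>

lemma rooted_tree_acyclic:
  assumes T: "rooted_tree V E r"
  shows "acyclic E"
proof -
  have no_cycle: "(v, v) \<notin> E\<^sup>+" if "(r, v) \<in> E\<^sup>*" for v
    using that
  proof induction
    case base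
    show ?case using T by (auto simp: rooted_tree_def elim: tranclE)
  next
    case (step u v)
    show ?case
    proof
      assume "(v, v) \<in> E\<^sup>+"
      then obtain u' where "(v, u') \<in> E\<^sup>*" "(u', v) \<in> E"
        by (meson tranclD2)
      then have "(u, u) \<in> E\<^sup>+"
        using rooted_tree_parent_unique[OF T] step.hyps(2) by (metis rtrancl_into_trancl2)
      then show False using step.IH by simp
    qed
  qed
  show ?thesis
  proof (rule acyclicI, rule allI, rule notI)
    fix v assume "(v, v) \<in> E\<^sup>+"
    moreover from this have "v \<in> V"
      using T unfolding rooted_tree_def by (metis (no_types, lifting) mem_Sigma_iff subsetD tranclD)
    ultimately show False using T no_cycle unfolding rooted_tree_def by blast
  qed
qed

text \<open>\<open>wf E\<close> gives induction from the root outwards, used for voltages;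
  \<open>wf (E\<inverse>)\<close> gives induction from the leaves inwards, used for flows.\<close>

lemma rooted_tree_wf:
  fixes E :: "('v::finite \<times> 'v) set"
  assumes "rooted_tree V E r"
  shows "wf E" "wf (E\<inverse>)"
  using rooted_tree_acyclic[OF assms] finite_acyclic_wf[of E] finite_acyclic_wf_converse[of E]
  by simp_all

abbreviation tree_network :: "'n::finite network \<Rightarrow> bool" where
  "tree_network G \<equiv> rooted_tree UNIV (lines G) None"

text \<open>Lets the power flow equations, which quantify over lines, be indexed by the child alone.
  The description is meaningful on a tree.\<close>

definition parent :: "'n::finite network \<Rightarrow> 'n \<Rightarrow> 'n option" where
  "parent G j = (THE i. (i, Some j) \<in> lines G)"

lemma line_iff_parent:
  assumes "tree_network G"
  shows "(i, Some j) \<in> lines G \<longleftrightarrow> i = parent G j"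
proof -
  have "\<exists>!i. (i, Some j) \<in> lines G" using assms unfolding rooted_tree_def by blast
  then show ?thesis unfolding parent_def by (metis theI)
qed

lemma no_line_into_root: "tree_network G \<Longrightarrow> (u, None) \<notin> lines G"
  by (simp add: rooted_tree_def)

lemma path_nodes_parent:
  assumes T: "tree_network G"
  shows "path_nodes G j =
    insert j (case parent G j of None \<Rightarrow> {} | Some i \<Rightarrow> path_nodes G i)"
proof -
  have *: "k \<in> path_nodes G j \<longleftrightarrow> k = j \<or> (Some k, parent G j) \<in> (lines G)\<^sup>*" for k
  proof -
    have "(Some k, Some j) \<in> (lines G)\<^sup>* \<longleftrightarrow>
        k = j \<or> (\<exists>i. (Some k, i) \<in> (lines G)\<^sup>* \<and> (i, Some j) \<in> lines G)"
      by (metis option.inject rtrancl.simps)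
    then show ?thesis by (simp add: path_nodes_def line_iff_parent[OF T])
  qed
  have "(Some k, None) \<notin> (lines G)\<^sup>*" for k
    using no_line_into_root[OF T] by (metis option.distinct(1) rtranclE)
  then show ?thesis
    using * by (auto simp: path_nodes_def split: option.split)
qed

lemma path_nodes_self_notin_parent:
  assumes T: "tree_network G" and "parent G j = Some i"
  shows "j \<notin> path_nodes G i"
proof
  assume "j \<in> path_nodes G i"
  then have "(Some j, Some i) \<in> (lines G)\<^sup>*" by (simp add: path_nodes_def)
  moreover have "(Some i, Some j) \<in> lines G" using assms by (simp add: line_iff_parent)
  ultimately show False
    using rooted_tree_acyclic[OF T] by (metis acyclic_def rtrancl_into_trancl1)
qed

definition subtree :: "'n::finite network \<Rightarrow> 'n \<Rightarrow> 'n set" where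
  "subtree G j = {m. j \<in> path_nodes G m}"

lemma subtree_children:
  assumes T: "tree_network G"
  shows "subtree G j = insert j (\<Union>k \<in> children G j. subtree G k)"
proof (intro equalityI subsetI)
  fix m assume "m \<in> subtree G j"
  then have "(Some j, Some m) \<in> (lines G)\<^sup>*" by (simp add: subtree_def path_nodes_def)
  then show "m \<in> insert j (\<Union>k \<in> children G j. subtree G k)"
  proof (cases rule: converse_rtranclE)
    case (step b)
    moreover obtain k where "b = Some k"
      using step(1) no_line_into_root[OF T] by (cases b) auto
    ultimately show ?thesis by (auto simp: subtree_def path_nodes_def children_def)
  qed simp
next
  fix m assume "m \<in> insert j (\<Union>k \<in> children G j. subtree G k)"
  then show "m \<in> subtree G j"
    by (auto simp: subtree_def path_nodes_def children_def intro: converse_rtrancl_into_rtrancl)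
qed

lemma root_notin_subtree_child:
  assumes T: "tree_network G" and "k \<in> children G j"
  shows "j \<notin> subtree G k"
proof -
  have "parent G k = Some j"
    using assms line_iff_parent[OF T] by (metis children_def mem_Collect_eq)
  then show ?thesis
    using path_nodes_self_notin_parent[OF T] by (simp add: subtree_def)
qed

text \<open>Each node has at most one parent, so the reversed lines are single valued: of two climbs
  starting at \<open>m\<close>, one continues the other.\<close>

lemma path_nodes_linear:
  assumes T: "tree_network G" and "k \<in> path_nodes G m" "l \<in> path_nodes G m"
  shows "k \<in> path_nodes G l \<or> l \<in> path_nodes G k"
proof -
  have "single_valued ((lines G)\<inverse>)"
    using rooted_tree_parent_unique[OF T] by (auto intro: single_valuedI)
  moreover have "(Some m, Some k) \<in> ((lines G)\<inverse>)\<^sup>*" "(Some m, Some l) \<in> ((lines G)\<inverse>)\<^sup>*"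
    using assms(2,3) by (auto simp: path_nodes_def rtrancl_converse)
  ultimately show ?thesis
    using single_valued_confluent[of "(lines G)\<inverse>" "Some m" "Some k" "Some l"]
    by (auto simp: path_nodes_def rtrancl_converse)
qed

text \<open>A common descendant would make one sibling an ancestor of the other, hence of their
  parent \<open>j\<close>, which closes a cycle. This lets a sum over a subtree split over the
  children.\<close>

lemma subtree_children_disjoint:
  assumes T: "tree_network G" and kl: "k \<in> children G j" "l \<in> children G j" "k \<noteq> l"
  shows "subtree G k \<inter> subtree G l = {}"
proof (rule ccontr)
  have par: "parent G k = Some j" "parent G l = Some j"
    using kl line_iff_parent[OF T] by (metis children_def mem_Collect_eq)+
  assume "subtree G k \<inter> subtree G l \<noteq> {}"
  then have "k \<in> path_nodes G l \<or> l \<in> path_nodes G k"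
    using path_nodes_linear[OF T] by (auto simp: subtree_def)
  then have "k \<in> path_nodes G j \<or> l \<in> path_nodes G j"
    using path_nodes_parent[OF T, of k] path_nodes_parent[OF T, of l] par kl(3) by auto
  then show False
    using path_nodes_self_notin_parent[OF T] par by blast
qed

section \<open>The linear power flow state\<close>

definition tree_flow :: "'n::finite network \<Rightarrow> ('n \<Rightarrow> complex) \<Rightarrow> 'n \<Rightarrow> complex" where
  "tree_flow G d j = (\<Sum>m \<in> subtree G j. d m)"

text \<open>Grouped by demands rather than by lines of the path, so that each node contributes a
  separate summand to the voltage at \<open>i\<close>.\<close>

definition tree_nu :: "'n::finite network \<Rightarrow> ('n \<Rightarrow> complex) \<Rightarrow> 'n \<Rightarrow> real" where
  "tree_nu G d i = nu0 G - 2 * (\<Sum>m \<in> UNIV. Re (cnj (common_imp G i m) * d m))"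

lemma tree_flow_rec:
  assumes T: "tree_network G"
  shows "tree_flow G d j = (\<Sum>k \<in> children G j. tree_flow G d k) + d j"
proof -
  have "tree_flow G d j = d j + (\<Sum>m \<in> (\<Union>k \<in> children G j. subtree G k). d m)"
    unfolding tree_flow_def subtree_children[OF T, of j]
    using root_notin_subtree_child[OF T] by (subst sum.insert) auto
  also have "(\<Sum>m \<in> (\<Union>k \<in> children G j. subtree G k). d m) =
      (\<Sum>k \<in> children G j. tree_flow G d k)"
    unfolding tree_flow_def
    using subtree_children_disjoint[OF T] by (subst sum.UNION_disjoint) auto
  finally show ?thesis by simp
qed

lemma tree_flow_unique:
  assumes T: "tree_network G"
    and rec: "\<And>j. f j = (\<Sum>k \<in> children G j. f k) + d j"
  shows "f = tree_flow G d"
proof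
  fix j
  \<comment> \<open>The well-founded relation lives on buses, so the claim is made for a bus
    \<open>b\<close>; it is vacuous at the substation.\<close>
  have "\<forall>j. b = Some j \<longrightarrow> f j = tree_flow G d j" for b
  proof (induction b rule: wf_induct_rule[OF rooted_tree_wf(2)[OF T]])
    case (1 b)
    show ?case
    proof (intro allI impI)
      fix j assume b: "b = Some j"
      have "(\<Sum>k \<in> children G j. f k) = (\<Sum>k \<in> children G j. tree_flow G d k)"
      proof (rule sum.cong)
        fix k assume "k \<in> children G j"
        then have "(Some k, b) \<in> (lines G)\<inverse>" using b by (simp add: children_def)
        from 1[OF this] show "f k = tree_flow G d k" by blast
      qed simp
      then show "f j = tree_flow G d j"
        using rec[of j] tree_flow_rec[OF T, of d j] by simp
    qed
  qed
  then show "f j = tree_flow G d j" by simp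
qed

text \<open>Double counting of a line \<open>k\<close> on the path to \<open>i\<close> together with
  a node \<open>m\<close> below \<open>k\<close>: for fixed \<open>m\<close> these lines are the
  ones common to the paths to \<open>i\<close> and to \<open>m\<close>.\<close>

lemma tree_nu_path:
  "tree_nu G d i = nu0 G - 2 * (\<Sum>k \<in> path_nodes G i. Re (cnj (imp G k) * tree_flow G d k))"
proof -
  have "(\<Sum>k \<in> path_nodes G i. Re (cnj (imp G k) * tree_flow G d k)) =
      (\<Sum>k \<in> path_nodes G i. \<Sum>m | k \<in> path_nodes G m. Re (cnj (imp G k) * d m))"
    unfolding tree_flow_def subtree_def sum_distrib_left Re_sum ..
  also have "\<dots> = (\<Sum>m \<in> UNIV. \<Sum>k | k \<in> path_nodes G i \<and> k \<in> path_nodes G m. Re (cnj (imp G k) * d m))"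
    using sum.swap_restrict[of "path_nodes G i" "UNIV" "\<lambda>k m. Re (cnj (imp G k) * d m)"
        "\<lambda>k m. k \<in> path_nodes G m"] by simp
  also have "\<dots> = (\<Sum>m \<in> UNIV. Re (cnj (common_imp G i m) * d m))"
    unfolding common_imp_def cnj_sum sum_distrib_right Re_sum Int_def ..
  finally show ?thesis by (simp add: tree_nu_def)
qed

text \<open>\<open>bus_nu\<close> for a bare voltage function, so that it applies to
  \<open>tree_nu\<close> before any state is built.\<close>

definition bus_value :: "'n network \<Rightarrow> ('n \<Rightarrow> real) \<Rightarrow> 'n option \<Rightarrow> real" where
  "bus_value G v b = (case b of None \<Rightarrow> nu0 G | Some i \<Rightarrow> v i)"

lemma tree_nu_rec:
  assumes T: "tree_network G"
  shows "tree_nu G d j =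
    bus_value G (tree_nu G d) (parent G j) - 2 * Re (cnj (imp G j) * tree_flow G d j)"
proof (cases "parent G j")
  case None
  then have "path_nodes G j = {j}" using path_nodes_parent[OF T, of j] by simp
  then show ?thesis by (simp add: tree_nu_path bus_value_def None)
next
  case (Some i)
  then have "path_nodes G j = insert j (path_nodes G i)" "j \<notin> path_nodes G i"
    using path_nodes_parent[OF T, of j] path_nodes_self_notin_parent[OF T] by simp_all
  then show ?thesis by (simp add: tree_nu_path bus_value_def Some algebra_simps)
qed

lemma tree_nu_unique:
  assumes T: "tree_network G"
    and rec: "\<And>j. v j =
      bus_value G v (parent G j) - 2 * Re (cnj (imp G j) * tree_flow G d j)"
  shows "v = tree_nu G d"
proof
  fix j
  \<comment> \<open>Including the substation gives the induction its start, where both sides are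
    \<open>nu0 G\<close>.\<close>
  have "bus_value G v b = bus_value G (tree_nu G d) b" for b
  proof (induction b rule: wf_induct_rule[OF rooted_tree_wf(1)[OF T]])
    case (1 b)
    show ?case
    proof (cases b)
      case None
      then show ?thesis by (simp add: bus_value_def)
    next
      case (Some j)
      then have "bus_value G v (parent G j) = bus_value G (tree_nu G d) (parent G j)"
        using 1 by (simp add: line_iff_parent[OF T])
      then show ?thesis
        using rec[of j] tree_nu_rec[OF T, of d j] Some by (simp add: bus_value_def)
    qed
  qed
  from this[of "Some j"] show "v j = tree_nu G d j" by (simp add: bus_value_def)
qed

section \<open>The state realised by an attack and a response\<close>

definition net_demand :: "'n::finite network \<Rightarrow> real \<Rightarrow> 'n attack \<Rightarrow> 'n response \<Rightarrow> 'n \<Rightarrow> complex" where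
  "net_demand G \<kappa> \<delta> \<phi> m = of_real \<kappa> * (consumption G \<phi> m - generation G \<delta> \<phi> m)"

definition tree_state :: "'n::finite network \<Rightarrow> real \<Rightarrow> 'n attack \<Rightarrow> 'n response \<Rightarrow> 'n pf_state" where
  "tree_state G \<kappa> \<delta> \<phi> = (let d = net_demand G \<kappa> \<delta> \<phi> in
    \<lparr>nu = tree_nu G d,
     ell = (\<lambda>j. (cmod (tree_flow G d j))\<^sup>2 / bus_value G (tree_nu G d) (parent G j)),
     sc = consumption G \<phi>, sg = generation G \<delta> \<phi>, flow = tree_flow G d\<rparr>)"

lemma bus_nu_eq_bus_value: "bus_nu G x = bus_value G (nu x)"
  by (simp add: fun_eq_iff bus_nu_def bus_value_def)

lemma lpf_parent_iff:
  assumes "tree_network G"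
  shows "lpf G \<kappa> x \<longleftrightarrow> (\<forall>j.
    flow x j = (\<Sum>k \<in> children G j. flow x k) + of_real \<kappa> * (sc x j - sg x j) \<and>
    nu x j = bus_value G (nu x) (parent G j) - 2 * Re (cnj (imp G j) * flow x j) \<and>
    ell x j = (cmod (flow x j))\<^sup>2 / bus_value G (nu x) (parent G j))"
  unfolding lpf_def line_iff_parent[OF assms] bus_nu_eq_bus_value by blast

text \<open>Existence and uniqueness at once, which turns the description in
  \<open>lpf_state\<close> into a concrete term. The equations are triangular: demands fix the
  flows, flows fix the voltages, and both fix \<open>ell\<close>.\<close>

lemma lpf_realises_iff:
  assumes T: "tree_network G"
  shows "lpf G \<kappa> x \<and> realises G \<delta> \<phi> x \<longleftrightarrow> x = tree_state G \<kappa> \<delta> \<phi>"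
proof
  let ?d = "net_demand G \<kappa> \<delta> \<phi>"
  assume x: "lpf G \<kappa> x \<and> realises G \<delta> \<phi> x"
  then have sc: "sc x = consumption G \<phi>" and sg: "sg x = generation G \<delta> \<phi>"
    by (simp_all add: realises_def)
  note eqs = conjunct1[OF x, unfolded lpf_parent_iff[OF T], rule_format]
  have "flow x j = (\<Sum>k \<in> children G j. flow x k) + ?d j" for j
    using eqs[of j] unfolding net_demand_def sc sg by blast
  then have flow: "flow x = tree_flow G ?d"
    by (rule tree_flow_unique[OF T])
  have "nu x j = bus_value G (nu x) (parent G j) - 2 * Re (cnj (imp G j) * tree_flow G ?d j)" for j
    using eqs[of j] unfolding flow by blast
  then have nu: "nu x = tree_nu G ?d"
    by (rule tree_nu_unique[OF T])
  have "ell x j = (cmod (tree_flow G ?d j))\<^sup>2 / bus_value G (tree_nu G ?d) (parent G j)" for j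
    using eqs[of j] unfolding flow nu by blast
  then have "ell x = (\<lambda>j. (cmod (tree_flow G ?d j))\<^sup>2 / bus_value G (tree_nu G ?d) (parent G j))"
    by (rule ext)
  then show "x = tree_state G \<kappa> \<delta> \<phi>"
    using flow nu sc sg by (simp add: tree_state_def Let_def)
next
  let ?d = "net_demand G \<kappa> \<delta> \<phi>"
  assume x: "x = tree_state G \<kappa> \<delta> \<phi>"
  have "nu x = tree_nu G ?d" "sc x = consumption G \<phi>" "sg x = generation G \<delta> \<phi>"
    "flow x = tree_flow G ?d"
    "ell x = (\<lambda>j. (cmod (tree_flow G ?d j))\<^sup>2 / bus_value G (tree_nu G ?d) (parent G j))"
    by (simp_all add: x tree_state_def Let_def)
  note fields = this
  show "lpf G \<kappa> x \<and> realises G \<delta> \<phi> x"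
    unfolding lpf_parent_iff[OF T] realises_def fields net_demand_def[symmetric]
    using tree_flow_rec[OF T, of ?d] tree_nu_rec[OF T, of ?d] by blast
qed

lemma lpf_state_eq_tree_state:
  assumes "tree_network G"
  shows "lpf_state G \<kappa> \<delta> \<phi> = tree_state G \<kappa> \<delta> \<phi>"
  using lpf_realises_iff[OF assms] by (simp add: lpf_state_def)

text \<open>The voltage predicted by the algorithm is exact for every attack, since voltages are
  affine in the demands and compromising \<open>m\<close> changes only the demand at
  \<open>m\<close>.\<close>

lemma nu_lpf_state_attack:
  fixes \<delta> :: "'n::finite attack"
  assumes T: "tree_network G" and \<delta>: "\<delta> \<in> attacks M"
  shows "nu (lpf_state G \<kappa> \<delta> \<phi>) i = pivot_nu G \<kappa> \<phi> i \<delta>"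
proof -
  have "2 * Re (cnj (common_imp G i m) * net_demand G \<kappa> \<delta> \<phi> m) =
      2 * Re (cnj (common_imp G i m) * net_demand G \<kappa> (\<lambda>_. 0) \<phi> m) +
      (if \<delta> m = 1 then Delta G \<kappa> \<phi> i m else 0)" for m
  proof -
    have "\<delta> m = 0 \<or> \<delta> m = 1" using \<delta> by (auto simp: attacks_def)
    \<comment> \<open>Replacing the set-point \<open>fst \<phi> m\<close> by
      \<open>- \<i> * sp_cap G m\<close> raises the net demand by \<kappa> times the sum
      \<open>fst \<phi> m + \<i> * sp_cap G m\<close> that occurs in \<open>Delta\<close>.\<close>
    then show ?thesis
      by (auto simp: net_demand_def generation_def Delta_def algebra_simps)
  qed
  then have "(\<Sum>m\<in>UNIV. 2 * Re (cnj (common_imp G i m) * net_demand G \<kappa> \<delta> \<phi> m)) =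
      (\<Sum>m\<in>UNIV. 2 * Re (cnj (common_imp G i m) * net_demand G \<kappa> (\<lambda>_. 0) \<phi> m)) +
      (\<Sum>m | \<delta> m = 1. Delta G \<kappa> \<phi> i m)"
    by (simp add: sum.distrib sum.If_cases)
  then show ?thesis
    by (simp add: lpf_state_eq_tree_state[OF T] tree_state_def pivot_nu_def Let_def tree_nu_def
        sum_distrib_left)
qed

section \<open>Optimality of the greedy attack\<close>

text \<open>Exchange argument: the common part cancels, \<open>B - A\<close> injects into
  \<open>A - B\<close> without decreasing any value, and the elements of \<open>A - B\<close> left
  over contribute nonnegatively.\<close>

lemma sum_le_sum_largest:
  fixes f :: "'a \<Rightarrow> real"
  assumes fin: "finite A" "finite B" and card: "card B \<le> card A"
    and nonneg: "\<And>a. a \<in> A \<Longrightarrow> 0 \<le> f a"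
    and top: "\<And>a b. a \<in> A \<Longrightarrow> b \<in> B - A \<Longrightarrow> f b \<le> f a"
  shows "sum f B \<le> sum f A"
proof -
  have "card (B - A) \<le> card (A - B)"
    using card fin by (metis card_le_sym_Diff)
  then obtain g where g: "g ` (B - A) \<subseteq> A - B" "inj_on g (B - A)"
    using card_le_inj[of "B - A" "A - B"] fin by auto
  have "sum f (B - A) \<le> (\<Sum>b \<in> B - A. f (g b))"
    using g(1) top by (intro sum_mono) auto
  also have "\<dots> = sum f (g ` (B - A))"
    using g(2) by (simp add: sum.reindex)
  also have "\<dots> \<le> sum f (A - B)"
    using g(1) fin nonneg by (intro sum_mono2) auto
  finally have "sum f (B \<inter> A) + sum f (B - A) \<le> sum f (A \<inter> B) + sum f (A - B)"
    by (simp add: Int_commute)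
  then show ?thesis
    using sum.Int_Diff[OF fin(1), of f B] sum.Int_Diff[OF fin(2), of f A] by simp
qed

text \<open>The last bound says that the attacker's set-point has the least possible imaginary
  part.\<close>

lemma setpoint_bounds:
  assumes "p \<in> setpoints G"
  shows "0 \<le> Re (p j)" "0 \<le> sp_cap G j" "- sp_cap G j \<le> Im (p j)"
proof -
  have "0 \<le> Re (p j)" "cmod (p j) \<le> sp_cap G j"
    using assms by (auto simp: setpoints_def)
  then show "0 \<le> Re (p j)" "0 \<le> sp_cap G j" "- sp_cap G j \<le> Im (p j)"
    using norm_ge_zero[of "p j"] abs_Im_le_cmod[of "p j"] by linarith+
qed

text \<open>With common impedance \<open>R + \<i> * X\<close> and set-point difference
  \<open>a + \<i> * b\<close>, the real part in \<open>Delta\<close> is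
  \<open>R * a + X * b\<close>, and all four numbers are nonnegative.\<close>

lemma Delta_nonneg:
  assumes G: "network_data G" and "\<phi> \<in> responses G" and \<kappa>: "0 \<le> \<kappa>"
  shows "0 \<le> Delta G \<kappa> \<phi> i j"
proof -
  have p: "fst \<phi> \<in> setpoints G" using assms(2) by (auto simp: responses_def)
  have "0 \<le> Re (imp G k)" "0 \<le> Im (imp G k)" for k
    using G by (auto simp: network_data_def less_imp_le)
  then have "0 \<le> Re (common_imp G i j)" "0 \<le> Im (common_imp G i j)"
    by (auto simp: common_imp_def intro!: sum_nonneg)
  then show ?thesis
    using setpoint_bounds[OF p, of j] \<kappa> by (simp add: Delta_def)
qed

text \<open>The pivot attack compromises exactly \<open>M\<close> nodes while a rival may compromise
  fewer; nonnegativity of \<open>Delta\<close> covers the difference.\<close>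

lemma pivot_attack_minimises_nu:
  assumes "network_data G" "\<phi> \<in> responses G" "0 \<le> \<kappa>"
    and piv: "pivot_attack G \<kappa> M \<phi> i \<delta>" and \<delta>': "\<delta>' \<in> attacks M"
  shows "pivot_nu G \<kappa> \<phi> i \<delta> \<le> pivot_nu G \<kappa> \<phi> i \<delta>'"
proof -
  have "{j. \<delta>' j \<noteq> 0} = {j. \<delta>' j = 1}" using \<delta>' by (auto simp: attacks_def)
  then have card: "card {j. \<delta>' j = 1} \<le> card {j. \<delta> j = 1}"
    using \<delta>' piv by (simp add: attacks_def pivot_attack_def)
  have "\<delta> l = 0" if "\<delta> l \<noteq> 1" for l
    using piv that by (auto simp: pivot_attack_def attacks_def)
  then have top: "Delta G \<kappa> \<phi> i l \<le> Delta G \<kappa> \<phi> i j" if "\<delta> j = 1" "\<delta> l \<noteq> 1" for j l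
    using piv that by (auto simp: pivot_attack_def)
  have "(\<Sum>j | \<delta>' j = 1. Delta G \<kappa> \<phi> i j) \<le> (\<Sum>j | \<delta> j = 1. Delta G \<kappa> \<phi> i j)"
    using card top Delta_nonneg[OF assms(1-3)] by (intro sum_le_sum_largest) auto
  then show ?thesis by (simp add: pivot_nu_def)
qed

text \<open>At each node \<open>i\<close> the attack \<open>d i\<close> does at least the harm of
  \<open>\<delta>'\<close>, and pivot \<open>k\<close> scores at least as high as pivot
  \<open>i\<close>. So every term of the loss under \<open>\<delta>'\<close> is bounded by the
  single term \<open>k\<close> of the loss under \<open>\<delta>\<close>.\<close>

lemma greedy_loss_VR_max:
  assumes G: "network_data G" and \<phi>: "\<phi> \<in> responses G" and \<kappa>: "0 \<le> \<kappa>"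
    and greedy: "greedy_output G \<kappa> M \<phi> \<delta>" and \<delta>': "\<delta>' \<in> attacks M"
  shows "loss_VR G (lpf_state G \<kappa> \<delta>' \<phi>) \<le> loss_VR G (lpf_state G \<kappa> \<delta> \<phi>)"
proof -
  have T: "tree_network G" and w: "\<And>i. 0 \<le> w_VR G i" using G by (auto simp: network_data_def)
  obtain d k where d: "\<And>i. pivot_attack G \<kappa> M \<phi> i (d i)" and \<delta>: "\<delta> = d k"
    and k: "\<And>i. w_VR G i * (nu_lo G i - pivot_nu G \<kappa> \<phi> i (d i)) \<le>
      w_VR G k * (nu_lo G k - pivot_nu G \<kappa> \<phi> k \<delta>)"
    using greedy by (auto simp: greedy_output_def is_arg_max_def not_less)
  have \<delta>_in: "\<delta> \<in> attacks M" using d \<delta> by (auto simp: pivot_attack_def)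
  \<comment> \<open>Pivots are compared without the positive part; nonnegative weights allow it to
    be moved outside the product, where it is monotone.\<close>
  have abs_eq: "\<bar>w_VR G i * max t 0\<bar> = max (w_VR G i * t) 0" for i t
    using w[of i] by (auto simp: max_def mult_nonneg_nonpos mult_le_0_iff zero_le_mult_iff)
  have loss_term: "\<bar>w_VR G i * max (nu_lo G i - nu (lpf_state G \<kappa> \<delta>' \<phi>) i) 0\<bar> \<le>
      \<bar>w_VR G k * max (nu_lo G k - nu (lpf_state G \<kappa> \<delta> \<phi>) k) 0\<bar>" for i
  proof -
    have "w_VR G i * (nu_lo G i - pivot_nu G \<kappa> \<phi> i \<delta>') \<le>
        w_VR G i * (nu_lo G i - pivot_nu G \<kappa> \<phi> i (d i))"
      using pivot_attack_minimises_nu[OF G \<phi> \<kappa> d \<delta>'] w by (intro mult_left_mono) auto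
    then show ?thesis
      using k[of i] unfolding abs_eq
      by (simp add: nu_lpf_state_attack[OF T \<delta>'] nu_lpf_state_attack[OF T \<delta>_in])
  qed
  show ?thesis
    unfolding loss_VR_def
  proof (rule Max.boundedI)
    fix a assume "a \<in> range (\<lambda>i. \<bar>w_VR G i * max (nu_lo G i - nu (lpf_state G \<kappa> \<delta>' \<phi>) i) 0\<bar>)"
    then have "a \<le> \<bar>w_VR G k * max (nu_lo G k - nu (lpf_state G \<kappa> \<delta> \<phi>) k) 0\<bar>"
      using loss_term by auto
    also have "\<dots> \<le> Max (range (\<lambda>i. \<bar>w_VR G i * max (nu_lo G i - nu (lpf_state G \<kappa> \<delta> \<phi>) i) 0\<bar>))"
      by (intro Max_ge) auto
    finally show "a \<le> \<dots>" .
  qed auto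
qed

section \<open>Feasibility and the master problem\<close>

text \<open>A compromised DER sits on the boundary of its half disc. Hence the generation itself is
  a witness for the set-points required by \<open>admissible\<close>.\<close>

lemma generation_in_setpoints:
  assumes "\<delta> \<in> attacks M" "\<phi> \<in> responses G"
  shows "generation G \<delta> \<phi> \<in> setpoints G"
proof -
  have p: "fst \<phi> \<in> setpoints G" using assms(2) by (auto simp: responses_def)
  have "0 \<le> Re (generation G \<delta> \<phi> i) \<and> cmod (generation G \<delta> \<phi> i) \<le> sp_cap G i" for i
  proof -
    have "\<delta> i = 0 \<or> \<delta> i = 1" using assms(1) by (auto simp: attacks_def)
    moreover have "0 \<le> Re (fst \<phi> i)" "cmod (fst \<phi> i) \<le> sp_cap G i"
      using p by (auto simp: setpoints_def)
    ultimately show ?thesis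
      using setpoint_bounds(2)[OF p, of i] by (auto simp: generation_def norm_mult)
  qed
  then show ?thesis by (simp add: setpoints_def)
qed

lemma lpf_state_feasible:
  assumes G: "network_data G" and "nu0 G = 1" and \<delta>: "\<delta> \<in> attacks M" and \<phi>: "\<phi> \<in> responses G"
    and hard: "hard_bounds G (lpf_state G \<kappa> \<delta> \<phi>)"
    and rev: "no_reverse_flow (lpf_state G \<kappa> \<delta> \<phi>)"
  shows "lpf_state G \<kappa> \<delta> \<phi> \<in> lpf_states G \<kappa>"
proof -
  let ?x = "lpf_state G \<kappa> \<delta> \<phi>"
  have T: "tree_network G" using G by (simp add: network_data_def)
  have lpf: "lpf G \<kappa> ?x" and real: "realises G \<delta> \<phi> ?x"
    using lpf_realises_iff[OF T] lpf_state_eq_tree_state[OF T] by blast+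
  have nu: "0 \<le> nu ?x i" for i
    using hard G unfolding hard_bounds_def network_data_def by (meson less_imp_le order_trans)
  \<comment> \<open>These are the denominators of \<open>ell\<close>; on a line leaving the
    substation the denominator is \<open>nu0 G\<close>.\<close>
  have bus: "0 \<le> bus_value G (nu ?x) b" for b
    using nu \<open>nu0 G = 1\<close> by (simp add: bus_value_def split: option.split)
  have ell: "0 \<le> ell ?x j" for j
  proof -
    have "ell ?x j = (cmod (flow ?x j))\<^sup>2 / bus_value G (nu ?x) (parent G j)"
      using lpf unfolding lpf_parent_iff[OF T] by blast
    then show ?thesis using bus[of "parent G j"] by simp
  qed
  have sc: "sc ?x i \<le>\<^sub>c sc_nom G i" for i
  proof -
    have "snd \<phi> i \<le> 1" "0 \<le> Re (sc_nom G i)" "0 \<le> Im (sc_nom G i)"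
      using \<phi> G by (auto simp: responses_def load_controls_def network_data_def cle_def)
    then show ?thesis
      using real mult_right_mono[of "snd \<phi> i" 1 "Re (sc_nom G i)"]
        mult_right_mono[of "snd \<phi> i" 1 "Im (sc_nom G i)"]
      by (simp add: realises_def consumption_def cle_def)
  qed
  have sg: "\<exists>sp \<in> setpoints G. \<forall>i. sg ?x i \<le>\<^sub>c sp i"
    using real generation_in_setpoints[OF \<delta> \<phi>] by (auto simp: realises_def cle_def)
  show ?thesis
    using lpf nu ell hard sc sg rev by (simp add: lpf_states_def admissible_def)
qed

text \<open>The load-control loss does not depend on the attack, so the voltage losses decide. The
  greedy attack is feasible by \<open>secure\<close> and beats all of \<open>attacks M\<close>, in
  particular the feasible ones.\<close>

lemma greedy_output_optimal:
  assumes G: "network_data G" and \<phi>: "\<phi> \<in> responses G" and \<kappa>: "0 \<le> \<kappa>" and nu0: "nu0 G = 1"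
    and secure: "\<And>\<delta>. \<delta> \<in> attacks M \<Longrightarrow>
      hard_bounds G (lpf_state G \<kappa> \<delta> \<phi>) \<and> no_reverse_flow (lpf_state G \<kappa> \<delta> \<phi>)"
    and greedy: "greedy_output G \<kappa> M \<phi> \<delta>"
  shows "optimal_attack G \<kappa> M \<phi> \<delta>"
proof -
  have \<delta>: "\<delta> \<in> attacks M"
    using greedy by (auto simp: greedy_output_def pivot_attack_def)
  then have "lpf_state G \<kappa> \<delta> \<phi> \<in> lpf_states G \<kappa>"
    using secure lpf_state_feasible[OF G nu0 _ \<phi>] by blast
  moreover have "lpf_loss G \<kappa> \<delta>' \<phi> \<le> lpf_loss G \<kappa> \<delta> \<phi>" if "\<delta>' \<in> attacks M" for \<delta>'
    using greedy_loss_VR_max[OF G \<phi> \<kappa> greedy that] by (simp add: lpf_loss_def)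
  ultimately show ?thesis
    using \<delta> by (auto simp: optimal_attack_def is_arg_max_def not_less)
qed

theorem proposition3:
  fixes G :: "'n::finite network"
    and M :: nat
    and e0 :: real
    and \<phi> :: "'n response"
  assumes "network_data G"
    and "M \<le> CARD('n)"
    and "standing_assumptions G M e0"
    and "\<phi> \<in> responses G"
  shows "(\<forall>\<delta>. greedy_output G 1 M \<phi> \<delta> \<longrightarrow> optimal_attack G 1 M \<phi> \<delta>) \<and>
         (\<forall>\<delta>. greedy_output G (1 + eps G e0) M \<phi> \<delta> \<longrightarrow> optimal_attack G (1 + eps G e0) M \<phi> \<delta>)"
proof -
  have nu0: "nu0 G = 1" and "e0 < 1" and secure: "secure_operation G M e0"
    using assms(3)
    unfolding standing_assumptions_def per_unit_bounds_def small_line_losses_def by blast+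
  \<comment> \<open>\<open>1 + eps G e0\<close> is an integer power of the positive number
    \<open>1 - e0\<close>.\<close>
  then have \<kappa>: "0 \<le> 1 + eps G e0" by (simp add: eps_def)
  have "hard_bounds G (lpf_state G \<kappa> \<delta> \<phi>) \<and> no_reverse_flow (lpf_state G \<kappa> \<delta> \<phi>)"
    if "\<delta> \<in> attacks M" "\<kappa> \<in> {1, 1 + eps G e0}" for \<delta> \<kappa>
    using secure assms(4) that unfolding secure_operation_def by blast
  then show ?thesis
    using greedy_output_optimal[OF assms(1,4) _ nu0] \<kappa> by auto
qed

end
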